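(* Let $X$ be a mixture set, let $\succcurlyeq$ be a binary relation on $X$, and let $P$ be any one of the following three properties: mixture-continuous, Archimedean, weakly Wold-continuous. Then $\succcurlyeq$ is representable by a mixture-linear function if and only if it is complete, transitive, independent and satisfies $P$.
   Context: A mixture set is a set $X$ with an operation assigning to each $x,y\in X$ and $\lambda\in[0,1]$ an element $x\lambda y\in X$ such that for all $x,y\in X$ and $\lambda,\mu\in[0,1]$: $x1y=x$; $x\lambda y=y(1-\lambda)x$; $(x\lambda y)\mu y=x(\lambda\mu)y$. $x\succ y$ iff $x\succcurlyeq y$ and not $y\succcurlyeq x$; $x\sim y$ iff $x\succcurlyeq y$ and $y\succcurlyeq x$. Complete: $x\succcurlyeq y$ or $y\succcurlyeq x$ for all $x,y\in X$. Independent: for all $x,y,z\in X$ and $\lambda\in(0,1)$, $x\succcurlyeq y$ implies $x\lambda z\succcurlyeq y\lambda z$. Mixture-continuous: for all $x,y,z\in X$, the sets $\{\lambda\in[0,1]:x\lambda y\succcurlyeq z\}$ and $\{\lambda\in[0,1]:z\succcurlyeq x\lambda y\}$ are closed. Archimedean: for all $x,y,z\in X$ with $x\succ y$ there exist $\lambda,\delta\in(0,1)$ with $x\lambda z\succ y$ and $x\succ y\delta z$. Weakly Wold-continuous: (i) $x\succ y$ implies that there exists $z\in X$ with $x\succ z\succ y$; and (ii) $x\succ z\succ y$ implies that there exists $\lambda\in[0,1]$ with $x\lambda y\sim z$. A function $l:X\to\mathbb{R}$ is mixture-linear if $l(x\lambda y)=\lambda l(x)+(1-\lambda)l(y)$ for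 all $x,y\in X$, $\lambda\in[0,1]$; $\succcurlyeq$ is representable by $l$ if $x\succcurlyeq y\iff l(x)\ge l(y)$ for all $x,y\in X$. *)

theory Defs
  imports Complex_Main
begin

text \<open>
  A mixture set is given by its carrier \<open>X\<close> and an operation \<open>mix\<close>, where \<open>mix x t y\<close> stands
  for the mixture with weight \<open>t\<close> on \<open>x\<close> and \<open>1 - t\<close> on \<open>y\<close>. The operation is constrained
  only for arguments in \<open>X\<close> and weights in \<open>{0..1}\<close>. The carrier may be empty.
\<close>

locale mixture_set =
  fixes X :: "'a set" and mix :: "'a \<Rightarrow> real \<Rightarrow> 'a \<Rightarrow> 'a"
  assumes mix_closed: "\<lbrakk>x \<in> X; y \<in> X; t \<in> {0..1}\<rbrakk> \<Longrightarrow> mix x t y \<in> X"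
    and mix_one: "\<lbrakk>x \<in> X; y \<in> X\<rbrakk> \<Longrightarrow> mix x 1 y = x"
    and mix_commute: "\<lbrakk>x \<in> X; y \<in> X; t \<in> {0..1}\<rbrakk> \<Longrightarrow> mix x t y = mix y (1 - t) x"
    and mix_mix: "\<lbrakk>x \<in> X; y \<in> X; s \<in> {0..1}; t \<in> {0..1}\<rbrakk>
      \<Longrightarrow> mix (mix x s y) t y = mix x (s * t) y"

text \<open>In a preference relation \<open>R\<close>, \<open>R x y\<close> means that \<open>x\<close> is weakly preferred to \<open>y\<close>.\<close>

definition strict_pref :: "('a \<Rightarrow> 'a \<Rightarrow> bool) \<Rightarrow> 'a \<Rightarrow> 'a \<Rightarrow> bool" where
  "strict_pref R x y \<longleftrightarrow> R x y \<and> \<not> R y x"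

definition indifferent :: "('a \<Rightarrow> 'a \<Rightarrow> bool) \<Rightarrow> 'a \<Rightarrow> 'a \<Rightarrow> bool" where
  "indifferent R x y \<longleftrightarrow> R x y \<and> R y x"

text \<open>Unlike \<open>totalp_on\<close>, completeness includes reflexivity (the case \<open>x = y\<close>).\<close>

definition complete_rel_on :: "'a set \<Rightarrow> ('a \<Rightarrow> 'a \<Rightarrow> bool) \<Rightarrow> bool" where
  "complete_rel_on X R \<longleftrightarrow> (\<forall>x\<in>X. \<forall>y\<in>X. R x y \<or> R y x)"

definition independent_rel ::
  "'a set \<Rightarrow> ('a \<Rightarrow> real \<Rightarrow> 'a \<Rightarrow> 'a) \<Rightarrow> ('a \<Rightarrow> 'a \<Rightarrow> bool) \<Rightarrow> bool" where
  "independent_rel X mix R \<longleftrightarrow>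
    (\<forall>x\<in>X. \<forall>y\<in>X. \<forall>z\<in>X. \<forall>t\<in>{0<..<1}. R x y \<longrightarrow> R (mix x t z) (mix y t z))"

text \<open>Since \<open>{0..1}\<close> is closed, being closed in \<open>{0..1}\<close> and in the real line coincide here.\<close>

definition mixture_continuous ::
  "'a set \<Rightarrow> ('a \<Rightarrow> real \<Rightarrow> 'a \<Rightarrow> 'a) \<Rightarrow> ('a \<Rightarrow> 'a \<Rightarrow> bool) \<Rightarrow> bool" where
  "mixture_continuous X mix R \<longleftrightarrow>
    (\<forall>x\<in>X. \<forall>y\<in>X. \<forall>z\<in>X.
      closed {t \<in> {0..1}. R (mix x t y) z} \<and> closed {t \<in> {0..1}. R z (mix x t y)})"

definition archimedean ::
  "'a set \<Rightarrow> ('a \<Rightarrow> real \<Rightarrow> 'a \<Rightarrow> 'a) \<Rightarrow> ('a \<Rightarrow> 'a \<Rightarrow> bool) \<Rightarrow> bool" where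
  "archimedean X mix R \<longleftrightarrow>
    (\<forall>x\<in>X. \<forall>y\<in>X. \<forall>z\<in>X. strict_pref R x y \<longrightarrow>
      (\<exists>s\<in>{0<..<1}. \<exists>t\<in>{0<..<1}.
        strict_pref R (mix x s z) y \<and> strict_pref R x (mix y t z)))"

definition weakly_Wold_continuous ::
  "'a set \<Rightarrow> ('a \<Rightarrow> real \<Rightarrow> 'a \<Rightarrow> 'a) \<Rightarrow> ('a \<Rightarrow> 'a \<Rightarrow> bool) \<Rightarrow> bool" where
  "weakly_Wold_continuous X mix R \<longleftrightarrow>
    (\<forall>x\<in>X. \<forall>y\<in>X. strict_pref R x y \<longrightarrow>
      (\<exists>z\<in>X. strict_pref R x z \<and> strict_pref R z y)) \<and>
    (\<forall>x\<in>X. \<forall>y\<in>X. \<forall>z\<in>X. strict_pref R x z \<and> strict_pref R z y \<longrightarrow>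
      (\<exists>t\<in>{0..1}. indifferent R (mix x t y) z))"

definition mixture_linear ::
  "'a set \<Rightarrow> ('a \<Rightarrow> real \<Rightarrow> 'a \<Rightarrow> 'a) \<Rightarrow> ('a \<Rightarrow> real) \<Rightarrow> bool" where
  "mixture_linear X mix l \<longleftrightarrow>
    (\<forall>x\<in>X. \<forall>y\<in>X. \<forall>t\<in>{0..1}. l (mix x t y) = t * l x + (1 - t) * l y)"

definition represents :: "'a set \<Rightarrow> ('a \<Rightarrow> real) \<Rightarrow> ('a \<Rightarrow> 'a \<Rightarrow> bool) \<Rightarrow> bool" where
  "represents X l R \<longleftrightarrow> (\<forall>x\<in>X. \<forall>y\<in>X. R x y \<longleftrightarrow> l x \<ge> l y)"

end

theory Submission imports Defs begin

text \<open>
  Each of the three properties yields, for complete, transitive and independent relations, two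
  facts: if \<open>x \<succ> y\<close>, then the open segment between \<open>x\<close> and \<open>y\<close> is not a single indifference
  class, and every \<open>z\<close> with \<open>x \<succcurlyeq> z \<succcurlyeq> y\<close> is indifferent to a mixture of \<open>x\<close> and \<open>y\<close>.
  By independence, an indifference between two points of a segment is transported by small
  homotheties to a neighbourhood of every interior point. As the open segment is connected, it
  would then be a single indifference class. Hence preference is strictly monotone along
  segments, and the weight of \<open>a\<close> in the mixture of \<open>a\<close> and \<open>b\<close> that is indifferent to \<open>z\<close> is a
  mixture-linear utility of \<open>z\<close> on the order interval between \<open>b\<close> and \<open>a\<close>. The value at \<open>z\<close> of a
  mixture-linear utility is determined by its values at two points that are not indifferent, so
  the utilities on all order intervals containing these two points, suitably normalised, agree.
\<close>

section \<open>Segments in a mixture set\<close>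

context mixture_set
begin

lemma mix_zero: "\<lbrakk>x \<in> X; y \<in> X\<rbrakk> \<Longrightarrow> mix x 0 y = y"
  using mix_commute[of x y 0] mix_one by simp

lemma mix_same:
  assumes "x \<in> X" "t \<in> {0..1}"
  shows "mix x t x = x"
  using mix_mix[of x x 0 t] assms by (simp add: mix_zero)

text \<open>Read from the side of \<open>y\<close>, the weights \<open>1 - s\<close> and
  \<open>1 - t\<close> simply multiply by \<open>mix_mix\<close>; commuting before and after gives
  the formula.\<close>

lemma mix_mix_self:
  assumes "x \<in> X" "y \<in> X" "s \<in> {0..1}" "t \<in> {0..1}"
  shows "mix x s (mix x t y) = mix x (1 - (1 - s) * (1 - t)) y"
proof -
  have "mix x s (mix x t y) = mix (mix x t y) (1 - s) x"
    using assms by (intro mix_commute mix_closed) auto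
  also have "mix x t y = mix y (1 - t) x"
    using assms by (intro mix_commute) auto
  also have "mix (mix y (1 - t) x) (1 - s) x = mix y ((1 - t) * (1 - s)) x"
    using assms by (intro mix_mix) auto
  also have "\<dots> = mix x (1 - (1 - t) * (1 - s)) y"
    using assms by (intro mix_commute) (auto intro: mult_le_one)
  finally show ?thesis
    using \<open>mix x t y = mix y (1 - t) x\<close> by (simp only: mult.commute)
qed

text \<open>The point of weight \<open>t\<close> lies between the point of weight \<open>s\<close>
  and \<open>y\<close>, so it is itself a mixture of that point with \<open>y\<close>, of weight
  \<open>t / s\<close>. The two rules for nested mixtures then apply.\<close>

lemma mix_on_line_le:
  assumes "x \<in> X" "y \<in> X" "s \<in> {0..1}" "t \<in> {0..1}" "u \<in> {0..1}" "t \<le> s"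
  shows "mix (mix x s y) u (mix x t y) = mix x (u * s + (1 - u) * t) y"
proof (cases "s = 0")
  case True
  with assms show ?thesis by (simp add: mix_zero mix_same)
next
  case False
  define r where "r = t / s"
  have r: "r \<in> {0..1}" "t = s * r" using assms False by (auto simp: r_def)
  let ?w = "mix x s y"
  have w: "?w \<in> X" using assms by (intro mix_closed)
  have q: "1 - (1 - u) * (1 - r) \<in> {0..1}"
    using assms r by (auto intro: mult_le_one)
  have "mix x t y = mix ?w r y"
    using assms r by (simp add: mix_mix)
  then have "mix ?w u (mix x t y) = mix ?w (1 - (1 - u) * (1 - r)) y"
    using mix_mix_self[OF w assms(2) assms(5) r(1)] by simp
  also have "\<dots> = mix x (s * (1 - (1 - u) * (1 - r))) y"
    using assms q by (intro mix_mix) auto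
  also have "s * (1 - (1 - u) * (1 - r)) = u * s + (1 - u) * t"
    by (simp add: r algebra_simps)
  finally show ?thesis .
qed

lemma mix_on_line:
  assumes "x \<in> X" "y \<in> X" "s \<in> {0..1}" "t \<in> {0..1}" "u \<in> {0..1}"
  shows "mix (mix x s y) u (mix x t y) = mix x (u * s + (1 - u) * t) y"
proof (cases "t \<le> s")
  case True
  with assms show ?thesis by (rule mix_on_line_le)
next
  case False
  have "mix (mix x s y) u (mix x t y) = mix (mix x t y) (1 - u) (mix x s y)"
    using assms by (intro mix_commute mix_closed)
  also have "\<dots> = mix x ((1 - u) * t + (1 - (1 - u)) * s) y"
    using assms False by (intro mix_on_line_le) auto
  finally show ?thesis by (simp add: add.commute)
qed

end

lemma mixture_linearD:
  "\<lbrakk>mixture_linear X mix l; x \<in> X; y \<in> X; t \<in> {0..1}\<rbrakk>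
    \<Longrightarrow> l (mix x t y) = t * l x + (1 - t) * l y"
  by (simp add: mixture_linear_def)

lemma representsD: "\<lbrakk>represents X l R; x \<in> X; y \<in> X\<rbrakk> \<Longrightarrow> R x y \<longleftrightarrow> l y \<le> l x"
  by (simp add: represents_def)

section \<open>Preferences along segments\<close>

locale independent_preference = mixture_set X mix
  for X :: "'a set" and mix :: "'a \<Rightarrow> real \<Rightarrow> 'a \<Rightarrow> 'a" +
  fixes R :: "'a \<Rightarrow> 'a \<Rightarrow> bool"
  assumes complete: "complete_rel_on X R"
    and trans: "transp_on X R"
    and indep: "independent_rel X mix R"
begin

lemma R_total: "\<lbrakk>x \<in> X; y \<in> X\<rbrakk> \<Longrightarrow> R x y \<or> R y x"
  using complete by (auto simp: complete_rel_on_def)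

lemma R_refl: "x \<in> X \<Longrightarrow> R x x"
  using R_total by blast

lemma R_trans: "\<lbrakk>R x y; R y z; x \<in> X; y \<in> X; z \<in> X\<rbrakk> \<Longrightarrow> R x z"
  using trans by (meson transp_onD)

lemma mix_mono_left:
  assumes "R x y" "x \<in> X" "y \<in> X" "z \<in> X" "t \<in> {0..1}"
  shows "R (mix x t z) (mix y t z)"
proof -
  consider "t = 0" | "t = 1" | "t \<in> {0<..<1}" using assms(5) by force
  then show ?thesis
  proof cases
    case 3
    with assms indep show ?thesis by (simp add: independent_rel_def)
  qed (use assms in \<open>simp_all add: mix_zero mix_one R_refl\<close>)
qed

lemma mix_mono:
  assumes "R x x'" "R y y'" "x \<in> X" "x' \<in> X" "y \<in> X" "y' \<in> X" "t \<in> {0..1}"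
  shows "R (mix x t y) (mix x' t y')"
proof -
  have "R (mix y (1 - t) x') (mix y' (1 - t) x')"
    using assms by (intro mix_mono_left) auto
  then have "R (mix x' t y) (mix x' t y')"
    using assms mix_commute[of x' y t] mix_commute[of x' y' t] by simp
  moreover have "R (mix x t y) (mix x' t y)"
    using assms by (intro mix_mono_left) auto
  ultimately show ?thesis
    using assms by (meson R_trans mix_closed)
qed

text \<open>The point \<open>mix x t y\<close> is weakly better than \<open>y\<close>, and the point
  of weight \<open>s\<close> arises by mixing it with \<open>y\<close>. Comparing it with its
  mixture with itself gives the claim.\<close>

lemma line_mono:
  assumes "R x y" "x \<in> X" "y \<in> X" "0 \<le> s" "s \<le> t" "t \<le> 1"
  shows "R (mix x t y) (mix x s y)"
proof (cases "t = 0")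
  case True
  with assms show ?thesis by (simp add: R_refl mix_closed)
next
  case False
  let ?w = "mix x t y"
  have w: "?w \<in> X" using assms by (intro mix_closed) auto
  have "R ?w (mix y t y)" using assms by (intro mix_mono_left) auto
  then have "R ?w y" using assms by (simp add: mix_same)
  moreover have r: "s / t \<in> {0..1}" using assms False by auto
  ultimately have "R (mix ?w (s / t) ?w) (mix ?w (s / t) y)"
    using w assms R_refl by (intro mix_mono) auto
  moreover have "mix ?w (s / t) y = mix x s y"
    using mix_mix[of x y t "s / t"] assms False r by simp
  ultimately show ?thesis using w r by (simp add: mix_same)
qed

text \<open>Together with \<open>line_mono\<close> the assumption says that all weights in the
  interval from \<open>m\<close> to \<open>l\<close> are tied. Shrunken copies of this interval
  around each interior weight make the indifference class locally constant.\<close>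

lemma tie_imp_interior_ties:
  assumes xy: "R x y" "x \<in> X" "y \<in> X"
    and tie: "R (mix x m y) (mix x l y)" "0 \<le> m" "m < l" "l \<le> 1"
    and s: "s \<in> {0<..<1}" and t: "t \<in> {0<..<1}"
  shows "R (mix x s y) (mix x t y)"
proof -
  \<comment> \<open>Encoding the class of a weight as a set turns ties into equalities, as
    \<open>connected_local_const\<close> demands.\<close>
  define F where "F r = {u \<in> {0..1}. indifferent R (mix x r y) (mix x u y)}" for r
  have p: "mix x r y \<in> X" if "r \<in> {0..1}" for r
    using xy that by (intro mix_closed)
  have local: "eventually (\<lambda>b. F a = F b) (at a within {0<..<1})" if a: "a \<in> {0<..<1}" for a
  proof -
    \<comment> \<open>The homothety with ratio \<open>v\<close> and centre \<open>w\<close> sends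
      the midpoint \<open>k\<close> of \<open>m\<close> and \<open>l\<close> to \<open>a\<close>;
      the bound \<open>min a (1 - a)\<close> on \<open>v\<close> keeps \<open>w\<close> in the unit
      interval. Below, \<open>c\<close> and \<open>d\<close> are the images of \<open>m\<close> and
      \<open>l\<close>.\<close>
    define v where "v = min a (1 - a)"
    define k where "k = (l + m) / 2"
    define w where "w = (a - v * k) / (1 - v)"
    have v: "0 < v" "v < 1" "v \<le> a" "v \<le> 1 - a" using a by (auto simp: v_def)
    have k: "0 \<le> k" "k \<le> 1" using tie by (auto simp: k_def)
    have "v * k \<le> v * 1" "v * (1 - k) \<le> v * 1" using v k by (auto intro!: mult_left_mono)
    then have "0 \<le> a - v * k" "a - v * k \<le> 1 - v"
      using v unfolding right_diff_distrib mult_1_right by linarith+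
    then have w: "w \<in> {0..1}" using v by (auto simp: w_def)
    have wv: "(1 - v) * w = a - v * k" using v by (simp add: w_def)
    define c where "c = v * m + (1 - v) * w"
    define d where "d = v * l + (1 - v) * w"
    have "v * m < v * k" "v * k < v * l" using v tie by (auto simp: k_def)
    then have cd: "c < a" "a < d" by (auto simp: c_def d_def wv)
    have "0 \<le> c" using v tie w by (auto simp: c_def)
    moreover have "d \<le> v * 1 + (1 - v) * 1"
      unfolding d_def using v tie w by (intro add_mono mult_left_mono) auto
    ultimately have cd01: "0 \<le> c" "d \<le> 1" by auto
    have "R (mix (mix x m y) v (mix x w y)) (mix (mix x l y) v (mix x w y))"
      using tie v w p by (intro mix_mono_left) auto
    then have cdR: "R (mix x c y) (mix x d y)"
      using xy tie v w by (simp add: mix_on_line c_def d_def)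
    \<comment> \<open>The chain runs from \<open>r\<close> down to \<open>c\<close>, across the
      transported tie to \<open>d\<close>, and down to \<open>q\<close>; the order of
      \<open>r\<close> and \<open>q\<close> is irrelevant.\<close>
    have le: "R (mix x r y) (mix x q y)" if "c < r" "r < d" "c < q" "q < d" for r q
    proof -
      have "R (mix x r y) (mix x c y)" "R (mix x d y) (mix x q y)"
        using xy that cd01 by (auto intro!: line_mono)
      moreover have "mix x c y \<in> X" "mix x d y \<in> X" "mix x r y \<in> X" "mix x q y \<in> X"
        using that cd01 by (auto intro!: p)
      ultimately show ?thesis using cdR by (meson R_trans)
    qed
    have "F a = F b" if "b \<in> {c<..<d}" for b
    proof -
      have "R (mix x a y) (mix x b y)" "R (mix x b y) (mix x a y)"
        using le that cd by auto
      moreover have "mix x a y \<in> X" "mix x b y \<in> X"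
        using that cd01 cd by (auto intro!: p)
      ultimately show ?thesis unfolding F_def indifferent_def
        by (blast intro: R_trans p)
    qed
    moreover have "eventually (\<lambda>b. b \<in> {c<..<d}) (nhds a)"
      using cd by (intro eventually_nhds_in_open) auto
    ultimately show ?thesis
      by (auto simp: eventually_at_filter elim: eventually_mono)
  qed
  have "F s = F t"
    using connected_Ioo[of 0 "1::real"] s t local by (rule connected_local_const[rule_format])
  moreover have "t \<in> F t"
    using t R_refl p by (auto simp: F_def indifferent_def)
  ultimately show ?thesis by (auto simp: F_def indifferent_def)
qed

end

section \<open>Consequences of the continuity properties\<close>

text \<open>At weight 1 a mixture is its first component, so 1 lies outside the closed set of
  weights where the strict preference fails. Weights slightly below 1 then lie outside as
  well.\<close>

lemma mixture_continuous_imp_archimedean: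
  assumes mix: "mixture_set X mix" and complete: "complete_rel_on X R"
    and cont: "mixture_continuous X mix R"
  shows "archimedean X mix R"
proof -
  interpret mixture_set X mix by (rule mix)
  have near_one: "\<exists>s\<in>{0<..<1}. s \<notin> A" if "closed A" "1 \<notin> A" for A :: "real set"
  proof -
    have "eventually (\<lambda>s. s \<in> - A) (nhds 1)"
      using that by (intro eventually_nhds_in_open) auto
    then have "eventually (\<lambda>s. s \<in> - A) (at_left (1::real))"
      by (auto simp: eventually_at_filter elim: eventually_mono)
    moreover have "eventually (\<lambda>s. s \<in> {0<..<1}) (at_left (1::real))"
      by (rule eventually_at_left_real) simp
    ultimately have "eventually (\<lambda>s. s \<in> {0<..<1} \<and> s \<notin> A) (at_left (1::real))"
      by eventually_elim auto
    then show ?thesis using eventually_happens trivial_limit_at_left_real by blast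
  qed
  show ?thesis
    unfolding archimedean_def
  proof (intro ballI impI)
    fix x y z assume X: "x \<in> X" "y \<in> X" "z \<in> X" and xy: "strict_pref R x y"
    from xy have n: "\<not> R y x" by (simp add: strict_pref_def)
    have "closed {t \<in> {0..1}. R y (mix x t z)}" "closed {t \<in> {0..1}. R (mix y t z) x}"
      using cont X by (auto simp: mixture_continuous_def)
    from this[THEN near_one]
    obtain s t where st: "s \<in> {0<..<1}" "\<not> R y (mix x s z)" "t \<in> {0<..<1}" "\<not> R (mix y t z) x"
      using n X by (auto simp: mix_one)
    then have "mix x s z \<in> X" "mix y t z \<in> X" using X by (auto intro!: mix_closed)
    then have "strict_pref R (mix x s z) y \<and> strict_pref R x (mix y t z)"
      using st complete X by (auto simp: complete_rel_on_def strict_pref_def)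
    with st show "\<exists>s\<in>{0<..<1}. \<exists>t\<in>{0<..<1}.
        strict_pref R (mix x s z) y \<and> strict_pref R x (mix y t z)"
      by blast
  qed
qed

context independent_preference
begin

lemma archimedeanD:
  assumes "archimedean X mix R" "\<not> R y x" "x \<in> X" "y \<in> X" "z \<in> X"
  shows "\<exists>s\<in>{0<..<1}. \<exists>t\<in>{0<..<1}. \<not> R y (mix x s z) \<and> \<not> R (mix y t z) x"
  using assms R_total[of x y] unfolding archimedean_def strict_pref_def by blast

text \<open>The midpoint is strictly separated from at least one end. Moving that end slightly
  towards the other keeps it separated from the midpoint and makes it an interior point.\<close>

lemma archimedean_imp_interior_not_flat:
  assumes arch: "archimedean X mix R"
    and X: "x \<in> X" "y \<in> X" and xy: "\<not> R y x"
  shows "\<exists>s\<in>{0<..<1}. \<exists>t\<in>{0<..<1}. \<not> R (mix x s y) (mix x t y)"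
proof -
  let ?c = "mix x (1 / 2) y"
  have c: "?c \<in> X" using X by (intro mix_closed) auto
  have "\<not> R ?c x \<or> \<not> R y ?c" using xy X c R_trans by blast
  then show ?thesis
  proof
    assume "\<not> R ?c x"
    from archimedeanD[OF arch this X(1) c X(2)] show ?thesis by force
  next
    assume "\<not> R y ?c"
    from archimedeanD[OF arch this c X(2) X(1)] obtain t where t: "t \<in> {0<..<1}" "\<not> R (mix y t x) ?c"
      by blast
    then have "\<not> R (mix x (1 - t) y) ?c" using mix_commute[of y x t] X by simp
    with t show ?thesis by (intro bexI[of _ "1 - t"] bexI[of _ "1 / 2"]) auto
  qed
qed

text \<open>The supremum \<open>u\<close> of the weights whose mixture is not better than
  \<open>z\<close> solves the equation: at a strict preference in either direction the Archimedean
  property lets the weight move a little, which contradicts the choice of \<open>u\<close>.\<close>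

lemma archimedean_imp_solvable:
  assumes arch: "archimedean X mix R"
    and X: "x \<in> X" "y \<in> X" "z \<in> X" and xz: "R x z" and zy: "R z y"
  shows "\<exists>t\<in>{0..1}. indifferent R (mix x t y) z"
proof -
  have xy: "R x y" using R_trans xz zy X by blast
  define A where "A = {t \<in> {0..1}. R z (mix x t y)}"
  have A0: "0 \<in> A" using X zy by (simp add: A_def mix_zero)
  have bdd: "bdd_above A" by (rule bdd_aboveI[of _ 1]) (auto simp: A_def)
  define u where "u = Sup A"
  have "0 \<le> u" unfolding u_def using A0 bdd by (rule cSup_upper)
  moreover have "u \<le> 1" unfolding u_def
    by (rule cSup_least) (use A0 in \<open>blast, auto simp: A_def\<close>)
  ultimately have u: "u \<in> {0..1}" by simp
  have p: "mix x u y \<in> X" using X u by (intro mix_closed)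
  have "R z (mix x u y)"
  proof (rule ccontr)
    assume n: "\<not> R z (mix x u y)"
    with A0 have "u \<noteq> 0" by (auto simp: A_def)
    from archimedeanD[OF arch n p X(3) X(2)] obtain s where s: "s \<in> {0<..<1}"
      and "\<not> R z (mix (mix x u y) s y)" by blast
    then have nz: "\<not> R z (mix x (u * s) y)" using X u by (simp add: mix_mix)
    have us: "u * s \<in> {0..1}" using u s by (auto intro: mult_le_one)
    \<comment> \<open>The mixture of weight \<open>u * s\<close> is still better than
      \<open>z\<close>, hence so are all mixtures of larger weight.\<close>
    have "Sup A \<le> u * s"
    proof (rule cSup_least)
      show "A \<noteq> {}" using A0 by blast
      fix t assume t: "t \<in> A"
      show "t \<le> u * s"
      proof (rule ccontr)
        assume "\<not> t \<le> u * s"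
        then have "R (mix x t y) (mix x (u * s) y)"
          using t us xy X by (intro line_mono) (auto simp: A_def)
        moreover have "mix x t y \<in> X" "mix x (u * s) y \<in> X"
          using t X us by (auto simp: A_def intro!: mix_closed)
        ultimately show False using t nz R_trans X by (auto simp: A_def)
      qed
    qed
    with u s \<open>u \<noteq> 0\<close> show False by (auto simp: u_def[symmetric])
  qed
  moreover have "R (mix x u y) z"
  proof (rule ccontr)
    assume n: "\<not> R (mix x u y) z"
    have "u \<noteq> 1" using n X xz by (auto simp: mix_one)
    from archimedeanD[OF arch n X(3) p X(1)] obtain s where s: "s \<in> {0<..<1}"
      and nz: "\<not> R (mix (mix x u y) s x) z" by blast
    \<comment> \<open>The weight of \<open>x\<close> after moving the point of weight
      \<open>u\<close> towards \<open>x\<close>; it exceeds \<open>u\<close> and still belongs to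
      \<open>A\<close>.\<close>
    define v where "v = s * u + (1 - s)"
    have "mix (mix x u y) s x = mix x v y"
      using mix_on_line[of x y u 1 s] X u s by (simp add: mix_one v_def)
    with nz have nv: "\<not> R (mix x v y) z" by simp
    have "v - u = (1 - s) * (1 - u)" "1 - v = s * (1 - u)"
      by (simp_all add: v_def algebra_simps)
    moreover have "0 < (1 - s) * (1 - u)" "0 \<le> s * (1 - u)"
      using s u \<open>u \<noteq> 1\<close> by auto
    ultimately have "0 < v - u" "0 \<le> 1 - v" by presburger+
    then have v: "v > u" "v \<in> {0..1}" using u by auto
    then have "mix x v y \<in> X" using X by (intro mix_closed)
    then have "v \<in> A" using nv v R_total X by (auto simp: A_def)
    then have "v \<le> u" unfolding u_def using bdd by (rule cSup_upper)
    with v show False by simp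
  qed
  ultimately show ?thesis using u by (auto simp: indifferent_def)
qed

lemma Wold_imp_solvable:
  assumes wold: "weakly_Wold_continuous X mix R"
    and X: "x \<in> X" "y \<in> X" "z \<in> X" and xz: "R x z" and zy: "R z y"
  shows "\<exists>t\<in>{0..1}. indifferent R (mix x t y) z"
proof -
  consider "R z x" | "R y z" | "strict_pref R x z" "strict_pref R z y"
    using xz zy by (auto simp: strict_pref_def)
  then show ?thesis
  proof cases
    case 1
    then show ?thesis using xz X by (intro bexI[of _ 1]) (auto simp: indifferent_def mix_one)
  next
    case 2
    then show ?thesis using zy X by (intro bexI[of _ 0]) (auto simp: indifferent_def mix_zero)
  next
    case 3
    then show ?thesis using wold X unfolding weakly_Wold_continuous_def by blast
  qed
qed

text \<open>If the open segment were tied with its midpoint, condition (ii) would tie every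
  \<open>z\<close> strictly between \<open>x\<close> and \<open>y\<close> with the midpoint. But
  condition (i) supplies such a \<open>z\<close> strictly between the midpoint and one of the
  ends.\<close>

lemma Wold_imp_interior_not_flat:
  assumes wold: "weakly_Wold_continuous X mix R"
    and X: "x \<in> X" "y \<in> X" and xy: "\<not> R y x"
  shows "\<exists>s\<in>{0<..<1}. \<exists>t\<in>{0<..<1}. \<not> R (mix x s y) (mix x t y)"
proof (rule ccontr)
  let ?c = "mix x (1 / 2) y"
  assume "\<not> ?thesis"
  then have flat: "R (mix x t y) ?c" "R ?c (mix x t y)" if "t \<in> {0<..<1}" for t
    using that by auto
  have c: "?c \<in> X" using X by (intro mix_closed) auto
  have dense: "\<exists>z\<in>X. \<not> R z a \<and> \<not> R b z" if "\<not> R b a" "a \<in> X" "b \<in> X" for a b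
    using wold that R_total[of a b] unfolding weakly_Wold_continuous_def strict_pref_def by blast
  have Rxy: "R x y" using xy X R_total by blast
  have xc: "R x ?c" using line_mono[of x y "1/2" 1] Rxy X by (simp add: mix_one)
  have cy: "R ?c y" using line_mono[of x y 0 "1/2"] Rxy X by (simp add: mix_zero)
  have tied: "R z ?c \<and> R ?c z" if z: "z \<in> X" "\<not> R z x" "\<not> R y z" for z
  proof -
    have "strict_pref R x z \<and> strict_pref R z y"
      using z X R_total by (auto simp: strict_pref_def)
    then obtain t where t: "t \<in> {0..1}" and zt: "R (mix x t y) z" "R z (mix x t y)"
      using wold X z unfolding weakly_Wold_continuous_def indifferent_def by blast
    have "t \<noteq> 0" "t \<noteq> 1" using zt z X by (auto simp: mix_zero mix_one)
    with t have "t \<in> {0<..<1}" by auto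
    moreover have "mix x t y \<in> X" using t X by (intro mix_closed)
    ultimately show ?thesis using flat zt z c R_trans by blast
  qed
  have "\<not> R ?c x \<or> \<not> R y ?c" using xy X c R_trans by blast
  then show False
  proof
    assume "\<not> R ?c x"
    with dense X c obtain z where z: "z \<in> X" "\<not> R z x" "\<not> R ?c z" by blast
    then have "\<not> R y z" using cy R_trans X c by blast
    with tied z show False by blast
  next
    assume "\<not> R y ?c"
    with dense X c obtain z where z: "z \<in> X" "\<not> R z ?c" "\<not> R y z" by blast
    then have "\<not> R z x" using xc R_trans X c by blast
    with tied z show False by blast
  qed
qed

end

section \<open>Construction of the utility\<close>

text \<open>The second assumption asks for interior weights because a tie spreads only over the open
  segment, so only a strict preference inside it refutes the tie.\<close>

locale solvable_preference = independent_preference +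
  assumes solvable:
      "\<lbrakk>R x z; R z y; x \<in> X; y \<in> X; z \<in> X\<rbrakk> \<Longrightarrow> \<exists>t\<in>{0..1}. indifferent R (mix x t y) z"
    and interior_not_flat: "\<lbrakk>\<not> R y x; x \<in> X; y \<in> X\<rbrakk>
      \<Longrightarrow> \<exists>s\<in>{0<..<1}. \<exists>t\<in>{0<..<1}. \<not> R (mix x s y) (mix x t y)"
begin

lemma line_iff:
  assumes "\<not> R y x" "x \<in> X" "y \<in> X" "s \<in> {0..1}" "t \<in> {0..1}"
  shows "R (mix x s y) (mix x t y) \<longleftrightarrow> t \<le> s"
proof
  have xy: "R x y" using assms R_total by blast
  show "R (mix x s y) (mix x t y)" if "t \<le> s"
    using xy assms that by (intro line_mono) auto
  show "t \<le> s" if "R (mix x s y) (mix x t y)"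
    using interior_not_flat[OF assms(1-3)] tie_imp_interior_ties[OF xy assms(2,3) that] assms(4,5)
    by force
qed

text \<open>The worse end comes first, as in interval notation.\<close>

definition order_interval :: "'a \<Rightarrow> 'a \<Rightarrow> 'a set" where
  "order_interval b a = {z \<in> X. R a z \<and> R z b}"

lemma mix_in_order_interval:
  assumes "p \<in> order_interval b a" "q \<in> order_interval b a" "a \<in> X" "b \<in> X" "t \<in> {0..1}"
  shows "mix p t q \<in> order_interval b a"
proof -
  have "mix p t q \<in> X" using assms by (intro mix_closed) (auto simp: order_interval_def)
  moreover have "R (mix a t a) (mix p t q)" "R (mix p t q) (mix b t b)"
    using assms by (auto intro!: mix_mono simp: order_interval_def)
  ultimately show ?thesis using assms by (simp add: order_interval_def mix_same)
qed

lemma interval_utility: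
  assumes ab: "\<not> R b a" "a \<in> X" "b \<in> X"
  obtains f where "mixture_linear (order_interval b a) mix f" "represents (order_interval b a) f R"
proof -
  let ?I = "order_interval b a"
  have "\<forall>z\<in>?I. \<exists>t. t \<in> {0..1} \<and> indifferent R (mix a t b) z"
    using solvable ab by (fastforce simp: order_interval_def)
  then obtain f where f: "\<And>z. z \<in> ?I \<Longrightarrow> f z \<in> {0..1} \<and> indifferent R (mix a (f z) b) z"
    by metis
  have fX: "mix a (f z) b \<in> X" if "z \<in> ?I" for z
    using f that ab by (intro mix_closed) auto
  have IX: "z \<in> X" if "z \<in> ?I" for z using that by (simp add: order_interval_def)
  have rep: "represents ?I f R"
    unfolding represents_def
  proof (intro ballI)
    fix z w assume zw: "z \<in> ?I" "w \<in> ?I"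
    have "R z w \<longleftrightarrow> R (mix a (f z) b) (mix a (f w) b)"
      using f[OF zw(1)] f[OF zw(2)] fX zw IX R_trans unfolding indifferent_def by meson
    then show "R z w \<longleftrightarrow> f z \<ge> f w" using line_iff ab f zw by blast
  qed
  have "mixture_linear ?I mix f"
    unfolding mixture_linear_def
  proof (intro ballI)
    fix z w and t :: real assume zw: "z \<in> ?I" "w \<in> ?I" and t: "t \<in> {0..1}"
    let ?m = "mix z t w" and ?s = "t * f z + (1 - t) * f w"
    have m: "?m \<in> ?I" using zw t ab by (intro mix_in_order_interval)
    then have mX: "?m \<in> X" by (rule IX)
    have "0 \<le> ?s" using t f zw by auto
    moreover have "?s \<le> t * 1 + (1 - t) * 1"
      using t f zw by (intro add_mono mult_left_mono) auto
    ultimately have s: "?s \<in> {0..1}" by auto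
    \<comment> \<open>Mixing the stand-ins of \<open>z\<close> and \<open>w\<close> on the segment
      gives its point of weight \<open>?s\<close>, and independence ties this point with
      \<open>?m\<close>. By \<open>line_iff\<close> tied points of the segment have equal
      weights.\<close>
    have "mix (mix a (f z) b) t (mix a (f w) b) = mix a ?s b"
      using f zw ab t by (intro mix_on_line) auto
    moreover have "R (mix (mix a (f z) b) t (mix a (f w) b)) ?m"
      "R ?m (mix (mix a (f z) b) t (mix a (f w) b))"
      using f zw t fX IX by (auto intro!: mix_mono simp: indifferent_def)
    ultimately have "R (mix a ?s b) ?m" "R ?m (mix a ?s b)" by auto
    moreover have "mix a ?s b \<in> X" using ab s by (intro mix_closed)
    ultimately have "R (mix a ?s b) (mix a (f ?m) b)" "R (mix a (f ?m) b) (mix a ?s b)"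
      using f[OF m] mX fX[OF m] R_trans unfolding indifferent_def by blast+
    then show "f ?m = ?s" using line_iff ab s f[OF m] by fastforce
  qed
  with rep show ?thesis using that by blast
qed

text \<open>The values at \<open>x\<close> and \<open>y\<close> remove the freedom of a positive
  affine change, so that utilities on different intervals can be compared.\<close>

definition normalized_utility :: "'a \<Rightarrow> 'a \<Rightarrow> 'a \<Rightarrow> 'a \<Rightarrow> ('a \<Rightarrow> real) \<Rightarrow> bool" where
  "normalized_utility x y b a f \<longleftrightarrow>
    a \<in> X \<and> b \<in> X \<and> x \<in> order_interval b a \<and> y \<in> order_interval b a \<and>
    mixture_linear (order_interval b a) mix f \<and> represents (order_interval b a) f R \<and>
    f x = 1 \<and> f y = 0"

lemma normalized_utility_exists:
  assumes ab: "a \<in> X" "b \<in> X" and xy: "\<not> R y x" "x \<in> order_interval b a" "y \<in> order_interval b a"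
  shows "\<exists>f. normalized_utility x y b a f"
proof -
  let ?I = "order_interval b a"
  have "\<not> R b a"
    using xy ab R_trans unfolding order_interval_def by blast
  then obtain f where f: "mixture_linear ?I mix f" "represents ?I f R"
    using interval_utility ab by blast
  define d where "d = f x - f y"
  have d: "d > 0" using representsD[OF f(2) xy(3,2)] xy(1) by (simp add: d_def)
  define g where "g z = (f z - f y) / d" for z
  have "mixture_linear ?I mix g"
    using f(1) d by (auto simp: mixture_linear_def g_def field_simps)
  moreover have "represents ?I g R"
    using f(2) d by (simp add: represents_def g_def divide_le_cancel)
  moreover have "g x = 1" "g y = 0" using d by (auto simp: g_def d_def)
  ultimately show ?thesis using ab xy by (auto simp: normalized_utility_def)
qed

lemma normalized_utility_mix:
  assumes f: "normalized_utility x y b a f"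
    and I: "p \<in> order_interval b a" "q \<in> order_interval b a" "r \<in> order_interval b a"
    and t: "t \<in> {0..1}" and ind: "indifferent R (mix p t q) r"
  shows "f r = t * f p + (1 - t) * f q"
proof -
  have lin: "mixture_linear (order_interval b a) mix f"
    and rep: "represents (order_interval b a) f R"
    and m: "mix p t q \<in> order_interval b a"
    using f I t by (auto simp: normalized_utility_def intro: mix_in_order_interval)
  have "f r = f (mix p t q)"
    using representsD[OF rep m I(3)] representsD[OF rep I(3) m] ind by (auto simp: indifferent_def)
  then show ?thesis using mixture_linearD[OF lin I(1,2) t] by simp
qed

text \<open>Among \<open>x\<close>, \<open>y\<close> and \<open>z\<close> the middle one is tied
  with a mixture of the outer two. This gives a linear equation for \<open>f z\<close> whose
  coefficients depend neither on \<open>f\<close> nor on the interval.\<close>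

lemma normalized_utility_unique:
  assumes xy: "\<not> R y x" "x \<in> X" "y \<in> X" and z: "z \<in> X"
  shows "\<exists>v. \<forall>f a b. normalized_utility x y b a f \<and> z \<in> order_interval b a \<longrightarrow> f z = v"
proof -
  have val: "f x = 1" "f y = 0" "x \<in> order_interval b a" "y \<in> order_interval b a"
    if "normalized_utility x y b a f" for a b f
    using that by (auto simp: normalized_utility_def)
  have "R x y" using xy R_total by blast
  consider "R x z" "R z y" | "R z x" | "R y z" using R_total xy z by blast
  then show ?thesis
  proof cases
    case 1
    then obtain t where t: "t \<in> {0..1}" "indifferent R (mix x t y) z" using solvable xy z by blast
    show ?thesis
      using normalized_utility_mix[OF _ _ _ _ t] val by (intro exI[of _ t]) fastforce
  next
    case 2
    then obtain t where t: "t \<in> {0..1}" "indifferent R (mix z t y) x"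
      using solvable[of z x y] \<open>R x y\<close> xy z by blast
    have "f z = 1 / t" if "normalized_utility x y b a f" "z \<in> order_interval b a" for f a b
    proof -
      have "1 = t * f z" using normalized_utility_mix[OF that(1) _ _ _ t] val[OF that(1)] that(2) by simp
      \<comment> \<open>The equation itself excludes \<open>t = 0\<close>; likewise
        \<open>t = 1\<close> in the last case.\<close>
      then show ?thesis by (cases "t = 0") (auto simp: field_simps)
    qed
    then show ?thesis by blast
  next
    case 3
    then obtain t where t: "t \<in> {0..1}" "indifferent R (mix x t z) y"
      using solvable[of x y z] \<open>R x y\<close> xy z by blast
    have "f z = - t / (1 - t)" if "normalized_utility x y b a f" "z \<in> order_interval b a" for f a b
    proof -
      have "0 = t + (1 - t) * f z"
        using normalized_utility_mix[OF that(1) _ _ _ t] val[OF that(1)] that(2) by simp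
      then show ?thesis by (cases "t = 1") (auto simp: field_simps)
    qed
    then show ?thesis by blast
  qed
qed

text \<open>Serves to place two arbitrary points in one interval with the two reference points. In
  the induction each end is replaced by the better, respectively worse, of itself and the new
  point.\<close>

lemma finite_subset_order_interval:
  assumes "finite F" "F \<noteq> {}" "F \<subseteq> X"
  shows "\<exists>a\<in>X. \<exists>b\<in>X. F \<subseteq> order_interval b a"
  using assms
proof (induction rule: finite_ne_induct)
  case (singleton u)
  then show ?case using R_refl by (auto simp: order_interval_def)
next
  case (insert u F)
  then obtain a b where ab: "a \<in> X" "b \<in> X" "F \<subseteq> order_interval b a" by auto
  have u: "u \<in> X" using insert by simp
  obtain a' where a': "a' \<in> X" "R a' a" "R a' u" using R_total R_refl ab u by metis
  obtain b' where b': "b' \<in> X" "R b b'" "R u b'" using R_total R_refl ab u by metis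
  have "F \<subseteq> order_interval b' a'"
  proof
    fix z assume "z \<in> F"
    then have z: "z \<in> X" "R a z" "R z b" using ab by (auto simp: order_interval_def)
    then show "z \<in> order_interval b' a'"
      using R_trans[OF a'(2) z(2)] R_trans[OF z(3) b'(2)] ab a' b' by (simp add: order_interval_def)
  qed
  then show ?case using a' b' u by (auto simp: order_interval_def)
qed

lemma representable: "\<exists>l. mixture_linear X mix l \<and> represents X l R"
proof (cases "\<forall>x\<in>X. \<forall>y\<in>X. R y x")
  \<comment> \<open>This case includes the empty carrier.\<close>
  case True
  then show ?thesis
    by (intro exI[of _ "\<lambda>_. 0"]) (auto simp: mixture_linear_def represents_def)
next
  case False
  then obtain x y where xy: "x \<in> X" "y \<in> X" "\<not> R y x" by blast
  obtain l where l: "l z = f z"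
    if "z \<in> X" "normalized_utility x y b a f" "z \<in> order_interval b a" for z f a b
    using normalized_utility_unique[OF xy(3,1,2)] by metis
  \<comment> \<open>Both remaining claims concern two points and their mixtures, which share an
    interval with \<open>x\<close> and \<open>y\<close>; there \<open>l\<close> coincides with a
    single normalised utility.\<close>
  have ext: "\<exists>a b f. normalized_utility x y b a f \<and> z \<in> order_interval b a \<and>
      w \<in> order_interval b a \<and> (\<forall>u \<in> order_interval b a. l u = f u)"
    if "z \<in> X" "w \<in> X" for z w
  proof -
    have "\<exists>a\<in>X. \<exists>b\<in>X. {x, y, z, w} \<subseteq> order_interval b a"
      using that xy by (intro finite_subset_order_interval) auto
    then obtain a b where I: "a \<in> X" "b \<in> X" "{x, y, z, w} \<subseteq> order_interval b a" by blast
    then obtain f where f: "normalized_utility x y b a f"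
      using normalized_utility_exists[of a b y x] xy(3) by auto
    have "\<forall>u \<in> order_interval b a. l u = f u"
      using l[OF _ f] by (auto simp: order_interval_def)
    with I f show ?thesis by blast
  qed
  have "mixture_linear X mix l"
    unfolding mixture_linear_def
  proof (intro ballI)
    fix z w and t :: real assume zw: "z \<in> X" "w \<in> X" and t: "t \<in> {0..1}"
    from ext[OF zw] obtain a b f where f: "normalized_utility x y b a f"
      and I: "z \<in> order_interval b a" "w \<in> order_interval b a"
      and lf: "\<forall>u \<in> order_interval b a. l u = f u" by blast
    moreover have "mix z t w \<in> order_interval b a"
      using f I t by (auto simp: normalized_utility_def intro: mix_in_order_interval)
    moreover have "f (mix z t w) = t * f z + (1 - t) * f w"
      using f I t by (auto simp: normalized_utility_def intro: mixture_linearD)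
    ultimately show "l (mix z t w) = t * l z + (1 - t) * l w" by simp
  qed
  moreover have "represents X l R"
    unfolding represents_def
  proof (intro ballI)
    fix z w assume "z \<in> X" "w \<in> X"
    from ext[OF this] show "R z w \<longleftrightarrow> l z \<ge> l w"
      by (auto simp: normalized_utility_def represents_def)
  qed
  ultimately show ?thesis by blast
qed

end

section \<open>Necessity\<close>

lemma representable_imp_mixture_continuous:
  assumes "mixture_set X mix" "mixture_linear X mix l" "represents X l R"
  shows "mixture_continuous X mix R"
  unfolding mixture_continuous_def
proof (intro ballI)
  fix x y z assume X: "x \<in> X" "y \<in> X" "z \<in> X"
  have *: "mix x t y \<in> X" "l (mix x t y) = t * l x + (1 - t) * l y" if "t \<in> {0..1}" for t
    using mixture_set.mix_closed[OF assms(1)] mixture_linearD[OF assms(2)] X that by blast+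
  have "{t \<in> {0..1}. R (mix x t y) z} = {0..1} \<inter> {t. l z \<le> t * l x + (1 - t) * l y}"
    "{t \<in> {0..1}. R z (mix x t y)} = {0..1} \<inter> {t. t * l x + (1 - t) * l y \<le> l z}"
    using * X representsD[OF assms(3)] by auto
  moreover have "closed {t. l z \<le> t * l x + (1 - t) * l y}"
    "closed {t. t * l x + (1 - t) * l y \<le> l z}"
    by (intro closed_Collect_le continuous_intros)+
  ultimately show "closed {t \<in> {0..1}. R (mix x t y) z} \<and> closed {t \<in> {0..1}. R z (mix x t y)}"
    by (simp add: closed_Int)
qed

lemma representable_imp_Wold_continuous:
  assumes "mixture_set X mix" "mixture_linear X mix l" "represents X l R"
  shows "weakly_Wold_continuous X mix R"
proof -
  have m: "mix x t y \<in> X" "l (mix x t y) = t * l x + (1 - t) * l y"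
    if "x \<in> X" "y \<in> X" "t \<in> {0..1}" for x y t
    using mixture_set.mix_closed[OF assms(1)] mixture_linearD[OF assms(2)] that by blast+
  have strict: "strict_pref R x y \<longleftrightarrow> l x > l y" if "x \<in> X" "y \<in> X" for x y
    using representsD[OF assms(3)] that by (auto simp: strict_pref_def)
  have "\<exists>z\<in>X. strict_pref R x z \<and> strict_pref R z y"
    if "x \<in> X" "y \<in> X" "strict_pref R x y" for x y
  proof (intro bexI[of _ "mix x (1/2) y"])
    show "mix x (1/2) y \<in> X" using that by (intro m) auto
    then show "strict_pref R x (mix x (1/2) y) \<and> strict_pref R (mix x (1/2) y) y"
      using that by (simp add: strict m)
  qed
  moreover have "\<exists>t\<in>{0..1}. indifferent R (mix x t y) z"
    if "x \<in> X" "y \<in> X" "z \<in> X" "strict_pref R x z" "strict_pref R z y" for x y z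
  proof -
    \<comment> \<open>The solution of \<open>t * l x + (1 - t) * l y = l z\<close>.\<close>
    define t where "t = (l z - l y) / (l x - l y)"
    have lt: "l z < l x" "l y < l z" using that strict by auto
    then have t: "t \<in> {0..1}" by (auto simp: t_def)
    have "t * (l x - l y) = l z - l y" using lt by (simp add: t_def)
    then have "l (mix x t y) = l z" using that t by (simp add: m algebra_simps)
    then have "indifferent R (mix x t y) z"
      using representsD[OF assms(3)] m(1) that t by (simp add: indifferent_def)
    with t show ?thesis by blast
  qed
  ultimately show ?thesis unfolding weakly_Wold_continuous_def by blast
qed

lemma representable_imp_independent_preference:
  assumes "mixture_set X mix" "mixture_linear X mix l" "represents X l R"
  shows "independent_preference X mix R"
proof -
  have "R (mix x t z) (mix y t z)"
    if "x \<in> X" "y \<in> X" "z \<in> X" "t \<in> {0<..<1}" "R x y" for x y z t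
  proof -
    have "mix x t z \<in> X" "mix y t z \<in> X"
      using that by (auto intro!: mixture_set.mix_closed[OF assms(1)])
    then show ?thesis
      using that representsD[OF assms(3)] mixture_linearD[OF assms(2)] by simp
  qed
  moreover have "transp_on X R"
    by (intro transp_onI) (auto simp: representsD[OF assms(3)])
  ultimately show ?thesis
    using assms(1) representsD[OF assms(3)]
    by (auto simp: independent_preference_def independent_preference_axioms_def
        complete_rel_on_def independent_rel_def)
qed

theorem corollary3:
  fixes X :: "'a set"
    and mix :: "'a \<Rightarrow> real \<Rightarrow> 'a \<Rightarrow> 'a"
    and R :: "'a \<Rightarrow> 'a \<Rightarrow> bool"
    and P :: "'a set \<Rightarrow> ('a \<Rightarrow> real \<Rightarrow> 'a \<Rightarrow> 'a) \<Rightarrow> ('a \<Rightarrow> 'a \<Rightarrow> bool) \<Rightarrow> bool"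
  assumes "mixture_set X mix"
    and "P \<in> {mixture_continuous, archimedean, weakly_Wold_continuous}"
  shows "(\<exists>l. mixture_linear X mix l \<and> represents X l R) \<longleftrightarrow>
    complete_rel_on X R \<and> transp_on X R \<and> independent_rel X mix R \<and> P X mix R"
proof
  assume "\<exists>l. mixture_linear X mix l \<and> represents X l R"
  then obtain l where l: "mixture_linear X mix l" "represents X l R" by blast
  interpret independent_preference X mix R
    using representable_imp_independent_preference assms(1) l .
  have "P X mix R"
    using representable_imp_mixture_continuous[OF assms(1) l] assms complete
      representable_imp_Wold_continuous[OF assms(1) l] mixture_continuous_imp_archimedean
    by auto
  then show "complete_rel_on X R \<and> transp_on X R \<and> independent_rel X mix R \<and> P X mix R"
    using complete trans indep by blast
next
  assume *: "complete_rel_on X R \<and> transp_on X R \<and> independent_rel X mix R \<and> P X mix R"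
  then interpret independent_preference X mix R
    using assms(1) by (simp add: independent_preference_def independent_preference_axioms_def)
  \<comment> \<open>Mixture continuity is absorbed into the Archimedean case.\<close>
  consider "archimedean X mix R" | "weakly_Wold_continuous X mix R"
    using * assms mixture_continuous_imp_archimedean by auto
  then have "solvable_preference X mix R"
  proof cases
    case 1
    then show ?thesis
      by unfold_locales (auto dest: archimedean_imp_solvable archimedean_imp_interior_not_flat)
  next
    case 2
    then show ?thesis
      by unfold_locales (auto dest: Wold_imp_solvable Wold_imp_interior_not_flat)
  qed
  then show "\<exists>l. mixture_linear X mix l \<and> represents X l R"
    by (rule solvable_preference.representable)
qed

end
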